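(* Let $\mathbf y\in\mathbb R^n$, $w^{(1)},\dots,w^{(d)}\in\mathbb R_{\ge0}^n$, $c_1,\dots,c_d\in\mathbb R$, with $x_i(\boldsymbol\lambda)=[\,y_i-\sum_j\lambda_jw^{(j)}_i\,]$, $h^{(j)}(\boldsymbol\lambda)=\sum_iw^{(j)}_ix_i(\boldsymbol\lambda)$, and for $t\in[d]$ let $\Delta_t(\lambda_1,\dots,\lambda_t)=h^{(t)}(\lambda_1,\dots,\lambda_d)$ where $\lambda_{t+1},\dots,\lambda_d$ are any values with $h^{(j)}(\boldsymbol\lambda)=c_j$ for all $j>t$. If $\Delta_t(\lambda_1,\dots,\lambda_{t-1},\lambda'_t)=\Delta_t(\lambda_1,\dots,\lambda_{t-1},\lambda''_t)=C$, then for every $\alpha\in[0,1]$, $\Delta_t(\lambda_1,\dots,\lambda_{t-1},\alpha\lambda'_t+(1-\alpha)\lambda''_t)=C$. Consequently (as $\Delta_t$ is continuous), $\Delta_t$ is monotone in $\lambda_t$.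
   Context: $[z]=\min(1,\max(-1,z))$. The value $\Delta_t(\lambda_1,\dots,\lambda_t)$ is independent of the choice of $\lambda_{t+1},\dots,\lambda_d$ satisfying the stated constraints. *)

theory Defs
  imports "HOL-Analysis.Analysis"
begin

definition clip :: "real \<Rightarrow> real" where
  "clip z = min 1 (max (-1) z)"

text \<open>Multiplier vectors are functions \<open>nat \<Rightarrow> real\<close> of which only the coordinates
  \<open>1, \<dots>, d\<close> are used.\<close>

definition xvec :: "real ^ 'n \<Rightarrow> (nat \<Rightarrow> real ^ 'n) \<Rightarrow> nat \<Rightarrow> (nat \<Rightarrow> real) \<Rightarrow> real ^ 'n" where
  "xvec y w d l = (\<chi> i. clip (y $ i - (\<Sum>j = 1..d. l j * w j $ i)))"

definition hfun :: "real ^ 'n \<Rightarrow> (nat \<Rightarrow> real ^ 'n) \<Rightarrow> nat \<Rightarrow> nat \<Rightarrow> (nat \<Rightarrow> real) \<Rightarrow> real" where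
  "hfun y w d j l = (\<Sum>i\<in>UNIV. w j $ i * xvec y w d l $ i)"

definition completion ::
  "real ^ 'n \<Rightarrow> (nat \<Rightarrow> real ^ 'n) \<Rightarrow> (nat \<Rightarrow> real) \<Rightarrow> nat \<Rightarrow> nat \<Rightarrow> (nat \<Rightarrow> real) \<Rightarrow> (nat \<Rightarrow> real) \<Rightarrow> bool"
  where
  "completion y w c d t l m \<longleftrightarrow>
     (\<forall>j\<in>{1..t}. m j = l j) \<and> (\<forall>j\<in>{t<..d}. hfun y w d j m = c j)"

text \<open>\<open>Delta\<close> is a partial function of \<open>(l 1, \<dots>, l t)\<close>: it is meaningful exactly on
  \<open>Delta_dom\<close>, the points for which admissible values of the remaining coordinates exist.
  Neither depends on \<open>l j\<close> for \<open>j > t\<close>.\<close>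

definition Delta_dom ::
  "real ^ 'n \<Rightarrow> (nat \<Rightarrow> real ^ 'n) \<Rightarrow> (nat \<Rightarrow> real) \<Rightarrow> nat \<Rightarrow> nat \<Rightarrow> (nat \<Rightarrow> real) set" where
  "Delta_dom y w c d t = {l. \<exists>m. completion y w c d t l m}"

definition Delta ::
  "real ^ 'n \<Rightarrow> (nat \<Rightarrow> real ^ 'n) \<Rightarrow> (nat \<Rightarrow> real) \<Rightarrow> nat \<Rightarrow> nat \<Rightarrow> (nat \<Rightarrow> real) \<Rightarrow> real" where
  "Delta y w c d t l = (THE v. \<exists>m. completion y w c d t l m \<and> v = hfun y w d t m)"

end

theory Submission
  imports Defs
begin

text \<open>
  Clipping is firmly nonexpansive, \<open>(clip a - clip b)\<^sup>2 \<le> (clip a - clip b) * (a - b)\<close>. Summing over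
  the coordinates, \<open>\<parallel>x(l) - x(m)\<parallel>\<^sup>2 \<le> (\<Sum>j. (m\<^sub>j - l\<^sub>j) * (h\<^sub>j(l) - h\<^sub>j(m)))\<close>. For admissible
  completions the terms with \<open>j > t\<close> vanish, which makes \<open>x\<close>, hence \<open>\<Delta>\<^sub>t\<close>, a Lipschitz
  function of \<open>(l\<^sub>1, \<dots>, l\<^sub>t)\<close>. If moreover only the \<open>t\<close>-th coordinate varies, the surviving
  term shows directly that \<open>\<Delta>\<^sub>t\<close> is decreasing in it, and that equal values of \<open>\<Delta>\<^sub>t\<close> force equal
  vectors \<open>x\<close>; as fibres of clipping are intervals, \<open>x\<close> is then also unchanged at convex
  combinations of the two completed multiplier vectors.
\<close>

text \<open>Both \<open>clip z\<close> and \<open>z - clip z\<close> are nondecreasing in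
  \<open>z\<close>, so their increments never have opposite signs.\<close>

lemma clip_firmly_nonexpansive: "(clip a - clip b)\<^sup>2 \<le> (clip a - clip b) * (a - b)"
proof -
  have "clip a \<le> clip b \<and> clip b - clip a \<le> b - a" if "a \<le> b" for a b
    using that by (auto simp: clip_def min_def max_def)
  then have "0 \<le> (clip a - clip b) * ((a - b) - (clip a - clip b))"
    by (cases "a \<le> b") (force intro: mult_nonpos_nonpos mult_nonneg_nonneg)+
  then show ?thesis
    by (simp add: power2_eq_square algebra_simps)
qed

text \<open>The combination lies between \<open>min a b\<close> and \<open>max a b\<close>, and
  monotonicity of \<open>clip\<close> squeezes its value.\<close>

lemma clip_convex_combination:
  assumes "clip a = v" "clip b = v" "0 \<le> \<alpha>" "\<alpha> \<le> 1"
  shows "clip (\<alpha> * a + (1 - \<alpha>) * b) = v"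
proof -
  have mono: "clip p \<le> clip q" if "p \<le> q" for p q
    using that by (auto simp: clip_def)
  have "min a b \<le> \<alpha> * a + (1 - \<alpha>) * b" "\<alpha> * a + (1 - \<alpha>) * b \<le> max a b"
    using convex_bound_le[of a "max a b" b \<alpha> "1 - \<alpha>"]
      convex_bound_le[of "- a" "- min a b" "- b" \<alpha> "1 - \<alpha>"] assms by auto
  from this[THEN mono] show ?thesis
    using assms by (auto simp: min_def max_def split: if_splits)
qed

lemma hfun_inner: "hfun y w d j l = w j \<bullet> xvec y w d l"
  by (simp add: hfun_def inner_vec_def)

lemma norm_xvec_diff_le:
  "(norm (xvec y w d l - xvec y w d m))\<^sup>2
    \<le> (\<Sum>j = 1..d. (m j - l j) * (hfun y w d j l - hfun y w d j m))"
proof -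
  let ?D = "xvec y w d l - xvec y w d m"
  have "(norm ?D)\<^sup>2 = (\<Sum>i\<in>UNIV. (?D $ i)\<^sup>2)"
    unfolding power2_norm_eq_inner by (simp add: inner_vec_def power2_eq_square)
  also have "\<dots> \<le> (\<Sum>i\<in>UNIV. ?D $ i * (\<Sum>j = 1..d. (m j - l j) * w j $ i))"
  proof (rule sum_mono)
    fix i
    show "(?D $ i)\<^sup>2 \<le> ?D $ i * (\<Sum>j = 1..d. (m j - l j) * w j $ i)"
      using clip_firmly_nonexpansive[of "y $ i - (\<Sum>j = 1..d. l j * w j $ i)"
          "y $ i - (\<Sum>j = 1..d. m j * w j $ i)"]
      by (simp add: xvec_def left_diff_distrib sum_subtractf)
  qed
  \<comment> \<open>Exchanging the sums over \<open>i\<close> and \<open>j\<close> collects each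
    multiplier increment in front of an inner product with \<open>w j\<close>.\<close>
  also have "\<dots> = (\<Sum>j = 1..d. (m j - l j) * (w j \<bullet> ?D))"
    unfolding inner_vec_def sum_distrib_left
    by (subst sum.swap) (simp add: mult_ac)
  finally show ?thesis
    by (simp add: hfun_inner inner_diff_right)
qed

text \<open>For \<open>j > t\<close> both completions give \<open>hfun\<close> the value
  \<open>c j\<close>; for \<open>j \<le> t\<close> they agree with \<open>l\<close> and
  \<open>l'\<close>.\<close>

lemma norm_xvec_diff_completion_le:
  assumes "completion y w c d t l m" "completion y w c d t l' m'" "t \<le> d"
  shows "(norm (xvec y w d m - xvec y w d m'))\<^sup>2
    \<le> (\<Sum>j = 1..t. (l' j - l j) * (hfun y w d j m - hfun y w d j m'))"
proof -
  have "(\<Sum>j = 1..d. (m' j - m j) * (hfun y w d j m - hfun y w d j m'))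
      = (\<Sum>j = 1..t. (l' j - l j) * (hfun y w d j m - hfun y w d j m'))"
    using assms by (intro sum.mono_neutral_cong_right) (auto simp: completion_def)
  then show ?thesis
    using norm_xvec_diff_le[of y w d m m'] by simp
qed

lemma norm_xvec_diff_completion_Lipschitz:
  assumes "completion y w c d t l m" "completion y w c d t l' m'" "t \<le> d"
  shows "norm (xvec y w d m - xvec y w d m') \<le> (\<Sum>j = 1..t. \<bar>l' j - l j\<bar> * norm (w j))"
    (is "?N \<le> ?S")
proof -
  have "?N\<^sup>2 \<le> (\<Sum>j = 1..t. (l' j - l j) * (hfun y w d j m - hfun y w d j m'))"
    by (rule norm_xvec_diff_completion_le[OF assms])
  also have "\<dots> \<le> (\<Sum>j = 1..t. \<bar>l' j - l j\<bar> * norm (w j) * ?N)"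
  proof (rule sum_mono)
    fix j
    have "\<bar>hfun y w d j m - hfun y w d j m'\<bar> \<le> norm (w j) * ?N"
      unfolding hfun_inner inner_diff_right[symmetric] by (rule Cauchy_Schwarz_ineq2)
    then have "\<bar>l' j - l j\<bar> * \<bar>hfun y w d j m - hfun y w d j m'\<bar> \<le> \<bar>l' j - l j\<bar> * (norm (w j) * ?N)"
      by (rule mult_left_mono) simp
    then show "(l' j - l j) * (hfun y w d j m - hfun y w d j m') \<le> \<bar>l' j - l j\<bar> * norm (w j) * ?N"
      using abs_ge_self[of "(l' j - l j) * (hfun y w d j m - hfun y w d j m')"]
      by (simp add: abs_mult mult.assoc)
  qed
  also have "\<dots> = ?S * ?N"
    by (simp add: sum_distrib_right)
  finally have "?N * ?N \<le> ?S * ?N"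
    by (simp add: power2_eq_square)
  \<comment> \<open>Cancelling a factor \<open>?N\<close> requires \<open>?N \<noteq> 0\<close>;
    otherwise the claim is just \<open>0 \<le> ?S\<close>.\<close>
  then show ?thesis
    by (cases "?N = 0") (simp_all add: sum_nonneg)
qed

text \<open>Well-definedness: for \<open>l' = l\<close> the Lipschitz bound is 0, so all completions
  of \<open>l\<close> share one vector \<open>xvec\<close>, and the definite description in
  \<open>Delta\<close> has a unique candidate.\<close>

lemma Delta_eq_hfun:
  assumes "completion y w c d t l m" "t \<le> d"
  shows "Delta y w c d t l = hfun y w d t m"
  unfolding Delta_def
proof (rule the_equality)
  show "\<exists>m'. completion y w c d t l m' \<and> hfun y w d t m = hfun y w d t m'"
    using assms by blast
next
  fix v
  assume "\<exists>m'. completion y w c d t l m' \<and> v = hfun y w d t m'"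
  then obtain m' where m': "completion y w c d t l m'" "v = hfun y w d t m'"
    by blast
  have "xvec y w d m = xvec y w d m'"
    using norm_xvec_diff_completion_Lipschitz[OF assms(1) m'(1) assms(2)] by simp
  then show "v = hfun y w d t m"
    by (simp add: m' hfun_inner)
qed

lemma Delta_Lipschitz:
  assumes "l \<in> Delta_dom y w c d t" "l' \<in> Delta_dom y w c d t" "t \<le> d"
  shows "\<bar>Delta y w c d t l - Delta y w c d t l'\<bar>
    \<le> norm (w t) * (\<Sum>j = 1..t. \<bar>l' j - l j\<bar> * norm (w j))"
proof -
  obtain m m' where m: "completion y w c d t l m" "completion y w c d t l' m'"
    using assms by (auto simp: Delta_dom_def)
  have "\<bar>Delta y w c d t l - Delta y w c d t l'\<bar> \<le> norm (w t) * norm (xvec y w d m - xvec y w d m')"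
    unfolding Delta_eq_hfun[OF m(1) assms(3)] Delta_eq_hfun[OF m(2) assms(3)]
      hfun_inner inner_diff_right[symmetric] by (rule Cauchy_Schwarz_ineq2)
  also have "\<dots> \<le> norm (w t) * (\<Sum>j = 1..t. \<bar>l' j - l j\<bar> * norm (w j))"
    by (intro mult_left_mono norm_xvec_diff_completion_Lipschitz[OF m assms(3)]) simp
  finally show ?thesis .
qed

text \<open>Functions \<open>nat \<Rightarrow> real\<close> carry the product topology. The
  Lipschitz bound involves only finitely many coordinates, each of them continuous, so it tends to
  0.\<close>

lemma continuous_on_Delta:
  assumes "t \<le> d"
  shows "continuous_on (Delta_dom y w c d t) (Delta y w c d t)"
  unfolding continuous_on_def
proof
  fix l
  assume l: "l \<in> Delta_dom y w c d t"
  let ?F = "at l within Delta_dom y w c d t"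
  let ?b = "\<lambda>k. norm (w t) * (\<Sum>j = 1..t. \<bar>l j - k j\<bar> * norm (w j))"
  have coord: "((\<lambda>k. k j) \<longlongrightarrow> l j) ?F" for j
    using continuous_on_product_coordinates[of j]
    by (metis UNIV_I continuous_on_def tendsto_within_subset subset_UNIV)
  have "(?b \<longlongrightarrow> norm (w t) * (\<Sum>j = 1..t. \<bar>l j - l j\<bar> * norm (w j))) ?F"
    by (intro tendsto_intros coord)
  then have "(?b \<longlongrightarrow> 0) ?F"
    by simp
  moreover have "\<forall>\<^sub>F k in ?F. norm (Delta y w c d t k - Delta y w c d t l) \<le> ?b k"
    using Delta_Lipschitz[OF _ l assms] by (auto simp: eventually_at_filter)
  ultimately have "((\<lambda>k. Delta y w c d t k - Delta y w c d t l) \<longlongrightarrow> 0) ?F"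
    by (rule Lim_null_comparison[rotated])
  then show "(Delta y w c d t \<longlongrightarrow> Delta y w c d t l) ?F"
    by (simp add: Lim_null[symmetric])
qed

text \<open>The prescribed values differ only at \<open>t\<close>, so one term of the sum survives.
  Nonnegativity of the left side gives monotonicity; vanishing of the right side gives equality of
  the vectors.\<close>

lemma norm_xvec_diff_update_le:
  assumes "completion y w c d t (l(t := r)) m" "completion y w c d t (l(t := s)) m'" "t \<in> {1..d}"
  shows "(norm (xvec y w d m - xvec y w d m'))\<^sup>2
    \<le> (s - r) * (Delta y w c d t (l(t := r)) - Delta y w c d t (l(t := s)))"
proof -
  have td: "t \<le> d"
    using assms by simp
  have "(\<Sum>j = 1..t. ((l(t := s)) j - (l(t := r)) j) * (hfun y w d j m - hfun y w d j m'))
      = (\<Sum>j\<in>{t}. ((l(t := s)) j - (l(t := r)) j) * (hfun y w d j m - hfun y w d j m'))"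
    using assms by (intro sum.mono_neutral_right) auto
  then show ?thesis
    using norm_xvec_diff_completion_le[OF assms(1,2) td]
    by (simp add: Delta_eq_hfun[OF assms(1) td] Delta_eq_hfun[OF assms(2) td])
qed

lemma antimono_on_Delta:
  assumes "t \<in> {1..d}"
  shows "antimono_on {s. l(t := s) \<in> Delta_dom y w c d t} (\<lambda>s. Delta y w c d t (l(t := s)))"
proof (rule monotone_onI)
  fix r s
  assume rs: "r \<in> {s. l(t := s) \<in> Delta_dom y w c d t}" "s \<in> {s. l(t := s) \<in> Delta_dom y w c d t}"
    "r \<le> s"
  then obtain m m' where "completion y w c d t (l(t := r)) m" "completion y w c d t (l(t := s)) m'"
    by (auto simp: Delta_dom_def)
  from norm_xvec_diff_update_le[OF this assms]
  have "0 \<le> (s - r) * (Delta y w c d t (l(t := r)) - Delta y w c d t (l(t := s)))"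
    by (rule order_trans[OF zero_le_power2])
  then show "Delta y w c d t (l(t := s)) \<le> Delta y w c d t (l(t := r))"
    using rs(3) by (cases "r = s") (auto simp: zero_le_mult_iff)
qed

lemma Delta_convex_combination:
  assumes "l(t := r) \<in> Delta_dom y w c d t" "l(t := s) \<in> Delta_dom y w c d t"
    and eq: "Delta y w c d t (l(t := r)) = Delta y w c d t (l(t := s))"
    and t: "t \<in> {1..d}" and \<alpha>: "0 \<le> \<alpha>" "\<alpha> \<le> 1"
  shows "l(t := \<alpha> * r + (1 - \<alpha>) * s) \<in> Delta_dom y w c d t"
    and "Delta y w c d t (l(t := \<alpha> * r + (1 - \<alpha>) * s)) = Delta y w c d t (l(t := r))"
proof -
  obtain m m' where m: "completion y w c d t (l(t := r)) m" "completion y w c d t (l(t := s)) m'"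
    using assms by (auto simp: Delta_dom_def)
  have x_eq: "xvec y w d m = xvec y w d m'"
    using norm_xvec_diff_update_le[OF m t] eq by simp
  \<comment> \<open>Whole completions are combined, including the coordinates beyond
    \<open>t\<close>; this witness also puts the intermediate point in
    \<open>Delta_dom\<close>.\<close>
  define k where "k = (\<lambda>j. \<alpha> * m j + (1 - \<alpha>) * m' j)"
  have "xvec y w d k $ i = xvec y w d m $ i" for i
  proof -
    \<comment> \<open>The argument of \<open>clip\<close> is affine in the multipliers, and the
      weights \<alpha> and \<open>1 - \<alpha>\<close> sum to 1.\<close>
    have "y $ i - (\<Sum>j = 1..d. k j * w j $ i)
        = \<alpha> * (y $ i - (\<Sum>j = 1..d. m j * w j $ i)) + (1 - \<alpha>) * (y $ i - (\<Sum>j = 1..d. m' j * w j $ i))"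
      by (simp add: k_def algebra_simps sum.distrib sum_subtractf sum_distrib_left)
    then show ?thesis
      using clip_convex_combination[OF _ _ \<alpha>] arg_cong[OF x_eq, of "\<lambda>x. x $ i"]
      by (simp add: xvec_def)
  qed
  then have x_k: "xvec y w d k = xvec y w d m"
    by (simp add: vec_eq_iff)
  have "k j = (l(t := \<alpha> * r + (1 - \<alpha>) * s)) j" if "j \<in> {1..t}" for j
    using m that by (auto simp: completion_def k_def algebra_simps)
  then have k: "completion y w c d t (l(t := \<alpha> * r + (1 - \<alpha>) * s)) k"
    using m(1) by (simp add: completion_def hfun_inner x_k)
  then show "l(t := \<alpha> * r + (1 - \<alpha>) * s) \<in> Delta_dom y w c d t"
    by (auto simp: Delta_dom_def)
  show "Delta y w c d t (l(t := \<alpha> * r + (1 - \<alpha>) * s)) = Delta y w c d t (l(t := r))"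
    using t by (simp add: Delta_eq_hfun[OF k] Delta_eq_hfun[OF m(1)] hfun_inner x_k)
qed

theorem mainTheorem5:
  fixes y :: "real ^ 'n" and w :: "nat \<Rightarrow> real ^ 'n" and c :: "nat \<Rightarrow> real" and d t :: nat
  assumes "\<forall>j\<in>{1..d}. \<forall>i. 0 \<le> w j $ i"
    and "t \<in> {1..d}"
  shows "(\<forall>l l' l'' C. \<forall>\<alpha>\<in>{0..1}.
            l(t := l') \<in> Delta_dom y w c d t \<and> Delta y w c d t (l(t := l')) = C \<and>
            l(t := l'') \<in> Delta_dom y w c d t \<and> Delta y w c d t (l(t := l'')) = C \<longrightarrow>
            l(t := \<alpha> * l' + (1 - \<alpha>) * l'') \<in> Delta_dom y w c d t \<and>
            Delta y w c d t (l(t := \<alpha> * l' + (1 - \<alpha>) * l'')) = C)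
       \<and> continuous_on (Delta_dom y w c d t) (Delta y w c d t)
       \<and> (\<forall>l. mono_on {s. l(t := s) \<in> Delta_dom y w c d t} (\<lambda>s. Delta y w c d t (l(t := s))) \<or>
              antimono_on {s. l(t := s) \<in> Delta_dom y w c d t} (\<lambda>s. Delta y w c d t (l(t := s))))"
proof (intro conjI allI ballI impI)
  fix l l' l'' C and \<alpha> :: real
  assume \<alpha>: "\<alpha> \<in> {0..1}"
    and *: "l(t := l') \<in> Delta_dom y w c d t \<and> Delta y w c d t (l(t := l')) = C \<and>
            l(t := l'') \<in> Delta_dom y w c d t \<and> Delta y w c d t (l(t := l'')) = C"
  show "l(t := \<alpha> * l' + (1 - \<alpha>) * l'') \<in> Delta_dom y w c d t"
    using * \<alpha> assms(2) by (intro Delta_convex_combination(1)) auto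
  show "Delta y w c d t (l(t := \<alpha> * l' + (1 - \<alpha>) * l'')) = C"
    using * \<alpha> assms(2) Delta_convex_combination(2)[of l t l' y w c d l'' \<alpha>] by simp
next
  show "continuous_on (Delta_dom y w c d t) (Delta y w c d t)"
    using assms(2) by (intro continuous_on_Delta) simp
next
  fix l
  show "mono_on {s. l(t := s) \<in> Delta_dom y w c d t} (\<lambda>s. Delta y w c d t (l(t := s))) \<or>
      antimono_on {s. l(t := s) \<in> Delta_dom y w c d t} (\<lambda>s. Delta y w c d t (l(t := s)))"
    \<comment> \<open>The second alternative holds for every \<open>l\<close>.\<close>
    using antimono_on_Delta[OF assms(2)] by blast
qed

end
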